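(* Let $M>1$, $\mathcal R=[1/M,M]$. For a positive integer $N$ let $\psi_N(x)=(1+2^{-N}x)^{2^N}$ and $$\hat K^{sc}_{\psi,N}=\{\boldsymbol x\in\mathcal R^2\times\mathbb R:\ x_1/x_2\ge\psi_N(x_3/x_2)\}.$$ For every $\epsilon\in(0,2M^2\log M)$ one can choose $N=O(\log(M^2\log M)+\log(1/\epsilon))$ such that, when $x_3$ is restricted to $[-2M\log M,\,2M\log M]$, $$K_{\exp}(0)\subseteq\hat K^{sc}_{\psi,N}\subseteq K_{\exp}(\epsilon).$$ Moreover $\hat K^{sc}_{\psi,N}$ is second-order-cone representable: it is the set of $\boldsymbol x\in\mathcal R^2\times\mathbb R$ for which there exist $r_1,\dots,r_N\in\mathbb R$ with $$r_k\ge0\ \ \forall k\in[N-1],\quad (2r_1,x_1-x_2,x_1+x_2)\in\mathcal L_3,\quad (2r_{k+1},r_k-x_2,r_k+x_2)\in\mathcal L_3\ \ \forall k\in[N-1],\quad r_N=x_2+2^{-N}x_3 .$$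
   Context: $[n]=\{1,\dots,n\}$ (empty for $n=0$); $\mathcal L_3=\{y\in\mathbb R^3:y_3\ge\sqrt{y_1^2+y_2^2}\}$. For $\alpha\in\mathbb R$, $K_{\exp}(\alpha)=\{\boldsymbol x\in\mathcal R^2\times\mathbb R:\ x_1/x_2\ge\exp(x_3/x_2-\alpha)\}$. Restricting $x_3$ to an interval means intersecting each set in the chain of inclusions with $\{\boldsymbol x: x_3\in[-2M\log M,2M\log M]\}$. $O(\cdot)$ is the usual asymptotic notation, describing growth in $M$ and $1/\epsilon$. *)

theory Defs
  imports "HOL-Analysis.Analysis" "HOL-Library.Landau_Symbols"
begin

definition lorentz3 :: "(real ^ 3) set" where
  "lorentz3 = {y. y $ 3 \<ge> sqrt ((y $ 1)\<^sup>2 + (y $ 2)\<^sup>2)}"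

definition box_R :: "real \<Rightarrow> real set" where
  "box_R M = {1 / M .. M}"

definition K_exp :: "real \<Rightarrow> real \<Rightarrow> (real ^ 3) set" where
  "K_exp M \<alpha> = {x. x $ 1 \<in> box_R M \<and> x $ 2 \<in> box_R M \<and>
                   x $ 1 / x $ 2 \<ge> exp (x $ 3 / x $ 2 - \<alpha>)}"

definition psi :: "nat \<Rightarrow> real \<Rightarrow> real" where
  "psi N x = (1 + x / 2 ^ N) ^ (2 ^ N)"

definition K_psi :: "real \<Rightarrow> nat \<Rightarrow> (real ^ 3) set" where
  "K_psi M N = {x. x $ 1 \<in> box_R M \<and> x $ 2 \<in> box_R M \<and>
                   x $ 1 / x $ 2 \<ge> psi N (x $ 3 / x $ 2)}"

definition slab :: "real \<Rightarrow> (real ^ 3) set" where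
  "slab M = {x. x $ 3 \<in> {- 2 * M * ln M .. 2 * M * ln M}}"

text \<open>
  The filter on pairs \<open>(M, \<epsilon>)\<close> expressing growth in \<open>M\<close> and \<open>1/\<epsilon>\<close>: either
  \<open>\<epsilon> \<rightarrow> 0\<close> uniformly over all \<open>M\<close> bounded away from \<open>1\<close>, or \<open>M \<rightarrow> \<infinity>\<close> uniformly
  over all bounded \<open>\<epsilon> > 0\<close>. It covers the joint limit, the limit \<open>\<epsilon> \<rightarrow> 0\<close> for each
  fixed \<open>M > 1\<close> and the limit \<open>M \<rightarrow> \<infinity>\<close> for each fixed \<open>\<epsilon>\<close>, all with one constant
  in \<open>O\<close>.  A bound for all \<open>0 < \<epsilon> < 2 M\<^sup>2 log M\<close> is not meant:
  \<open>log (M\<^sup>2 log M) + log (1/\<epsilon>)\<close> is negative for \<open>\<epsilon>\<close> near the upper end.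
\<close>
definition growth_filter :: "(real \<times> real) filter" where
  "growth_filter =
     sup (SUP M0\<in>{1<..}. principal {M0..} \<times>\<^sub>F at_right 0)
         (SUP e0\<in>{0<..}. at_top \<times>\<^sub>F principal {0<..e0})"

lemma eventually_growth_filter:
  "eventually P growth_filter \<longleftrightarrow>
     (\<forall>M0>1. \<exists>\<delta>>0. \<forall>M\<ge>M0. \<forall>\<epsilon>. 0 < \<epsilon> \<and> \<epsilon> < \<delta> \<longrightarrow> P (M, \<epsilon>)) \<and>
     (\<forall>e0>0. \<exists>M1. \<forall>M\<ge>M1. \<forall>\<epsilon>. 0 < \<epsilon> \<and> \<epsilon> \<le> e0 \<longrightarrow> P (M, \<epsilon>))"
proof -
  have 1: "eventually P (principal {M0..} \<times>\<^sub>F at_right 0) \<longleftrightarrow>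
      (\<exists>\<delta>>0. \<forall>M\<ge>M0. \<forall>\<epsilon>. 0 < \<epsilon> \<and> \<epsilon> < \<delta> \<longrightarrow> P (M, \<epsilon>))" (is "?L \<longleftrightarrow> ?R") for M0 :: real
  proof
    assume ?L
    then obtain Q S where "\<forall>M\<in>{M0..}. Q M" "eventually S (at_right (0::real))"
      and PQ: "\<And>x y. Q x \<Longrightarrow> S y \<Longrightarrow> P (x, y)"
      unfolding eventually_prod_filter eventually_principal by blast
    moreover obtain \<delta> where "\<delta> > 0" "\<And>y. 0 < y \<Longrightarrow> y < \<delta> \<Longrightarrow> S y"
      using \<open>eventually S _\<close> by (auto simp: eventually_at_right_field)
    ultimately show ?R by (meson atLeast_iff)
  next
    assume ?R
    then obtain \<delta> where d: "\<delta> > 0" "\<And>M \<epsilon>. M \<ge> M0 \<Longrightarrow> 0 < \<epsilon> \<Longrightarrow> \<epsilon> < \<delta> \<Longrightarrow> P (M, \<epsilon>)"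
      by blast
    have "eventually (\<lambda>y. 0 < y \<and> y < \<delta>) (at_right (0::real))"
      using d(1) by (auto simp: eventually_at_right_field)
    then show ?L
      unfolding eventually_prod_filter eventually_principal
      using d(2) by (intro exI[of _ "\<lambda>x. x \<ge> M0"] exI[of _ "\<lambda>y. 0 < y \<and> y < \<delta>"]) auto
  qed
  have 2: "eventually P (at_top \<times>\<^sub>F principal {0<..e0}) \<longleftrightarrow>
      (\<exists>M1. \<forall>M\<ge>M1. \<forall>\<epsilon>. 0 < \<epsilon> \<and> \<epsilon> \<le> e0 \<longrightarrow> P (M, \<epsilon>))" (is "?L \<longleftrightarrow> ?R") for e0 :: real
  proof
    assume ?L
    then obtain Q S where "eventually Q (at_top :: real filter)" "\<forall>y\<in>{0<..e0}. S y"
      and PQ: "\<And>x y. Q x \<Longrightarrow> S y \<Longrightarrow> P (x, y)"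
      unfolding eventually_prod_filter eventually_principal by blast
    moreover obtain M1 where "\<And>M. M \<ge> M1 \<Longrightarrow> Q M"
      using \<open>eventually Q _\<close> by (auto simp: eventually_at_top_linorder)
    ultimately show ?R by (meson greaterThanAtMost_iff)
  next
    assume ?R
    then obtain M1 where d: "\<And>M \<epsilon>. M \<ge> M1 \<Longrightarrow> 0 < \<epsilon> \<Longrightarrow> \<epsilon> \<le> e0 \<Longrightarrow> P (M, \<epsilon>)"
      by blast
    then show ?L
      unfolding eventually_prod_filter eventually_principal
      by (intro exI[of _ "\<lambda>x. x \<ge> M1"] exI[of _ "\<lambda>y. 0 < y \<and> y \<le> e0"])
         (auto simp: eventually_ge_at_top)
  qed
  show ?thesis
    by (simp add: growth_filter_def eventually_sup eventually_Sup 1 2) (simp only: Ball_def greaterThan_iff)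
qed

end

theory Submission imports Defs begin

text \<open>
  On the slab, \<open>t = x\<^sub>3 / x\<^sub>2\<close> satisfies \<open>\<bar>t\<bar> \<le> L = 2 M\<^sup>2 log M\<close>. Put \<open>n = 2^N\<close>. As soon as
  \<open>n \<ge> L\<close>, taking \<open>n\<close>-th powers in \<open>0 \<le> 1 + t/n \<le> exp (t/n)\<close> gives the first inclusion. From
  \<open>log (1 + s) \<ge> s - 2 s\<^sup>2\<close> for \<open>\<bar>s\<bar> \<le> 1/2\<close> one gets
  \<open>n log (1 + t/n) \<ge> t - 2 L\<^sup>2/n\<close>, which is at least \<open>t - \<epsilon>\<close> once \<open>n \<ge> 2 L\<^sup>2/\<epsilon>\<close>; because
  \<open>\<epsilon> < L\<close>, this choice also forces \<open>n \<ge> 2 L\<close>. Hence \<open>N\<close> of size \<open>log (L\<^sup>2/\<epsilon>)\<close> suffices.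

  The cone condition \<open>(2a, b - c, b + c) \<in> \<L>\<^sub>3\<close> says \<open>a\<^sup>2 \<le> b c\<close> with \<open>b + c \<ge> 0\<close>, so the
  system in \<open>r\<close> is repeated squaring of \<open>r\<^sub>N / x\<^sub>2 = 1 + 2\<^sup>-\<^sup>N x\<^sub>3 / x\<^sub>2\<close>.
\<close>

section \<open>Lorentz cone membership as a quadratic inequality\<close>

text \<open>Once \<open>b + c\<close> is nonnegative the root can be squared away, and
  \<open>(b + c)\<^sup>2 - (b - c)\<^sup>2 = 4 * b * c\<close>.\<close>

lemma vector_in_lorentz3_iff:
  "vector [2 * a, b - c, b + c] \<in> lorentz3 \<longleftrightarrow> b + c \<ge> 0 \<and> a\<^sup>2 \<le> b * c"
proof -
  have "sqrt ((2 * a)\<^sup>2 + (b - c)\<^sup>2) \<ge> 0"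
    by simp
  then have "vector [2 * a, b - c, b + c] \<in> lorentz3 \<longleftrightarrow>
      0 \<le> b + c \<and> sqrt ((2 * a)\<^sup>2 + (b - c)\<^sup>2) \<le> b + c"
    unfolding lorentz3_def mem_Collect_eq vector_3 by linarith
  also have "\<dots> \<longleftrightarrow> 0 \<le> b + c \<and> (2 * a)\<^sup>2 + (b - c)\<^sup>2 \<le> (b + c)\<^sup>2"
    using sqrt_le_D real_le_lsqrt by blast
  also have "\<dots> \<longleftrightarrow> 0 \<le> b + c \<and> a\<^sup>2 \<le> b * c"
    by (simp add: power2_eq_square algebra_simps)
  finally show ?thesis .
qed

section \<open>Comparison of \<open>psi\<close> with the exponential on the slab\<close>

text \<open>The bound on \<open>t\<close> keeps the base \<open>1 + t / 2 ^ N\<close> nonnegative,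
  so that raising to an even power preserves the inequality.\<close>

lemma psi_le_exp:
  assumes "\<bar>t\<bar> \<le> 2 ^ N"
  shows "psi N t \<le> exp t"
proof -
  have "0 \<le> 1 + t / 2 ^ N"
    using assms by (simp add: field_simps)
  then have "psi N t \<le> exp (t / 2 ^ N) ^ 2 ^ N"
    unfolding psi_def by (intro power_mono exp_ge_add_one_self)
  also have "\<dots> = exp t"
    by (simp flip: exp_of_nat_mult)
  finally show ?thesis .
qed

lemma exp_minus_le_psi:
  assumes "\<bar>t\<bar> \<le> 2 ^ N / 2" and "2 * t\<^sup>2 / 2 ^ N \<le> \<epsilon>"
  shows "exp (t - \<epsilon>) \<le> psi N t"
proof -
  define n where "n = (2::real) ^ N"
  have n: "n > 0" by (simp add: n_def)
  define s where "s = t / n"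
  have s: "\<bar>s\<bar> \<le> 1 / 2"
    using assms(1) n by (simp add: s_def field_simps n_def abs_mult)
  \<comment> \<open>The loss \<open>n * (2 * s\<^sup>2)\<close> equals
    \<open>2 * t\<^sup>2 / n\<close>, which the second assumption bounds by
    \<open>\<epsilon>\<close>.\<close>
  have "t - \<epsilon> \<le> n * (s - 2 * s\<^sup>2)"
    using assms(2) n by (simp add: s_def n_def[symmetric] field_simps power2_eq_square)
  also have "\<dots> \<le> n * ln (1 + s)"
    using abs_ln_one_plus_x_minus_x_bound[OF s] n by (intro mult_left_mono) linarith+
  finally have "exp (t - \<epsilon>) \<le> exp (n * ln (1 + s))"
    by simp
  also have "\<dots> = (1 + s) ^ 2 ^ N"
    using s exp_of_nat_mult[of "2 ^ N" "ln (1 + s)"] by (simp add: n_def)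
  finally show ?thesis
    by (simp add: psi_def s_def n_def)
qed

text \<open>Dividing by \<open>x $ 2\<close>, which may be as small as \<open>1 / M\<close>, costs
  one more factor \<open>M\<close>. The result is also the upper end of the range of
  \<open>\<epsilon>\<close>.\<close>

lemma slab_ratio_bound:
  assumes "M > 1" and "x \<in> slab M" and "x $ 2 \<in> box_R M"
  shows "\<bar>x $ 3 / x $ 2\<bar> \<le> 2 * M\<^sup>2 * ln M"
proof -
  have x2: "x $ 2 \<ge> 1 / M" "x $ 2 > 0"
    using assms by (auto simp: box_R_def intro: less_le_trans[of 0 "1 / M"])
  have "\<bar>x $ 3 / x $ 2\<bar> = \<bar>x $ 3\<bar> / x $ 2"
    using x2 by simp
  also have "\<dots> \<le> (2 * M * ln M) / (1 / M)"
    using assms x2 by (intro frac_le) (auto simp: slab_def)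
  finally show ?thesis
    by (simp add: power2_eq_square mult_ac)
qed

lemma K_psi_between_K_exp:
  assumes M: "M > 1" and \<epsilon>: "0 < \<epsilon>" "\<epsilon> < L" and L: "L = 2 * M\<^sup>2 * ln M"
    and N: "2 * L\<^sup>2 / \<epsilon> \<le> 2 ^ N"
  shows "K_exp M 0 \<inter> slab M \<subseteq> K_psi M N \<inter> slab M"
    and "K_psi M N \<inter> slab M \<subseteq> K_exp M \<epsilon> \<inter> slab M"
proof -
  \<comment> \<open>This is where \<open>\<epsilon> < L\<close> enters. The factor 2 on the left
    provides the bound \<open>2 ^ N / 2\<close> on \<open>t\<close> in
    \<open>exp_minus_le_psi\<close>.\<close>
  have "2 * L \<le> 2 * L\<^sup>2 / \<epsilon>"
    using \<epsilon> by (simp add: field_simps power2_eq_square)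
  then have L2: "2 * L \<le> 2 ^ N"
    using N by simp
  have eps: "2 * L\<^sup>2 \<le> \<epsilon> * 2 ^ N"
    using N \<epsilon> by (simp add: field_simps)
  have psi_bounds: "psi N t \<le> exp t" "exp (t - \<epsilon>) \<le> psi N t" if "\<bar>t\<bar> \<le> L" for t
  proof -
    show "psi N t \<le> exp t"
      using that L2 \<epsilon> by (intro psi_le_exp) linarith
    have "t\<^sup>2 \<le> L\<^sup>2"
      using that power_mono[of "\<bar>t\<bar>" L 2] by simp
    with eps have "2 * t\<^sup>2 \<le> \<epsilon> * 2 ^ N"
      by linarith
    then have "2 * t\<^sup>2 / 2 ^ N \<le> \<epsilon>"
      by (simp add: field_simps)
    then show "exp (t - \<epsilon>) \<le> psi N t"
      using that L2 by (intro exp_minus_le_psi) linarith+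
  qed
  have psi_ratio_bounds: "psi N (x $ 3 / x $ 2) \<le> exp (x $ 3 / x $ 2)"
      "exp (x $ 3 / x $ 2 - \<epsilon>) \<le> psi N (x $ 3 / x $ 2)"
    if "x \<in> slab M" "x $ 2 \<in> box_R M" for x
    using psi_bounds slab_ratio_bound[OF M that] unfolding L by blast+
  show "K_exp M 0 \<inter> slab M \<subseteq> K_psi M N \<inter> slab M"
    using psi_ratio_bounds(1) unfolding K_exp_def K_psi_def
    by (auto intro: order_trans simp del: exp_le_cancel_iff)
  show "K_psi M N \<inter> slab M \<subseteq> K_exp M \<epsilon> \<inter> slab M"
    using psi_ratio_bounds(2) unfolding K_exp_def K_psi_def
    by (auto intro: order_trans)
qed

section \<open>Choice of \<open>N\<close> and its growth\<close>

text \<open>The logarithm is negative when \<open>M\<close> is close to 1 and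
  \<open>\<epsilon>\<close> is not too small; \<open>nat\<close> then cuts it off at 0, and
  \<open>Suc\<close> ensures \<open>N \<ge> 1\<close>.\<close>

definition num_squarings :: "real \<Rightarrow> real \<Rightarrow> nat" where
  "num_squarings M \<epsilon> = Suc (nat \<lceil>log 2 (2 * (2 * M\<^sup>2 * ln M)\<^sup>2 / \<epsilon>)\<rceil>)"

lemma two_power_num_squarings:
  assumes "M > 1" and "\<epsilon> > 0"
  shows "2 * (2 * M\<^sup>2 * ln M)\<^sup>2 / \<epsilon> \<le> 2 ^ num_squarings M \<epsilon>"
proof -
  let ?y = "2 * (2 * M\<^sup>2 * ln M)\<^sup>2 / \<epsilon>"
  have "?y > 0"
    using assms by simp
  then have "?y = 2 powr log 2 ?y"
    by simp
  also have "\<dots> \<le> 2 powr real (num_squarings M \<epsilon>)"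
    unfolding num_squarings_def by (intro powr_mono) linarith+
  finally show ?thesis
    by (simp add: powr_realpow)
qed

lemma num_squarings_le:
  assumes "M > 1" and "\<epsilon> > 0"
    and D: "D = ln (M\<^sup>2 * ln M) + ln (1 / \<epsilon>)" and "D \<ge> 1" and "ln \<epsilon> \<le> D"
  shows "real (num_squarings M \<epsilon>) \<le> 11 * D"
proof -
  let ?y = "2 * (2 * M\<^sup>2 * ln M)\<^sup>2 / \<epsilon>"
  have pos: "M\<^sup>2 * ln M > 0"
    using assms by simp
  have "ln ?y = ln (8 * (M\<^sup>2 * ln M)\<^sup>2 / \<epsilon>)"
    by (simp add: power_mult_distrib)
  also have "\<dots> = ln (2 ^ 3) + 2 * ln (M\<^sup>2 * ln M) - ln \<epsilon>"
    using pos assms by (simp add: ln_div ln_mult_pos ln_realpow del: ln_mult)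
  \<comment> \<open>\<open>2 * D\<close> subtracts \<open>ln \<epsilon>\<close> twice, so one copy
    is added back; the hypothesis \<open>ln \<epsilon> \<le> D\<close> then controls it when
    \<open>\<epsilon> > 1\<close>.\<close>
  also have "\<dots> = 3 * ln 2 + 2 * D + ln \<epsilon>"
    using assms by (simp add: ln_div ln_realpow del: power_numeral)
  also have "\<dots> \<le> 3 * ln 2 + 3 * D"
    using assms by simp
  also have "\<dots> \<le> (3 + 6 * D) * ln 2"
  proof -
    have "ln 2 \<ge> (1 / 2 :: real)"
      using ln2_ge_two_thirds by simp
    then have "3 * D \<le> 6 * D * ln 2"
      using \<open>D \<ge> 1\<close> by simp
    then show ?thesis by (simp add: algebra_simps)
  qed
  finally have "log 2 ?y \<le> 3 + 6 * D"
    by (simp add: log_def field_simps)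
  \<comment> \<open>The ceiling and \<open>Suc\<close> add at most 2 to \<open>3 + 6 * D\<close>,
    and \<open>5 \<le> 5 * D\<close> gives the constant 11.\<close>
  then show ?thesis
    using \<open>D \<ge> 1\<close> unfolding num_squarings_def by linarith
qed

text \<open>Supplies the hypotheses of \<open>num_squarings_le\<close>: small
  \<open>\<epsilon>\<close> secures them in the first branch of the filter, large \<open>M\<close>
  in the second.\<close>

lemma eventually_growth_filter_ln:
  "eventually (\<lambda>(M, \<epsilon>). M > 1 \<and> \<epsilon> > 0 \<and> 1 \<le> ln (M\<^sup>2 * ln M) + ln (1 / \<epsilon>) \<and>
      ln \<epsilon> \<le> ln (M\<^sup>2 * ln M) + ln (1 / \<epsilon>)) growth_filter"
proof -
  \<comment> \<open>Used with \<open>K = exp 1\<close> for the lower bound 1, and with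
    \<open>K = \<epsilon>\<close> for the lower bound \<open>ln \<epsilon>\<close>.\<close>
  have ln_ge: "ln K \<le> ln (M\<^sup>2 * ln M) + ln (1 / \<epsilon>)"
    if "M > 1" "\<epsilon> > 0" "K > 0" "K * \<epsilon> \<le> M\<^sup>2 * ln M" for K M \<epsilon> :: real
  proof -
    have "ln (K * \<epsilon>) \<le> ln (M\<^sup>2 * ln M)"
      using that by (subst ln_le_cancel_iff) auto
    then show ?thesis
      using that by (simp add: ln_div ln_mult_pos)
  qed
  show ?thesis
    unfolding eventually_growth_filter prod.case
  proof (intro conjI allI impI)
    fix M0 :: real assume M0: "M0 > 1"
    define c where "c = M0\<^sup>2 * ln M0"
    have c: "c > 0" using M0 by (simp add: c_def)
    \<comment> \<open>\<open>c\<close> is the least value of \<open>M\<^sup>2 * ln M\<close> for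
      \<open>M \<ge> M0\<close>. Below \<open>c / exp 1\<close> the sum of logarithms is at least 1;
      below 1, \<open>ln \<epsilon>\<close> is at most 0.\<close>
    show "\<exists>\<delta>>0. \<forall>M\<ge>M0. \<forall>\<epsilon>. 0 < \<epsilon> \<and> \<epsilon> < \<delta> \<longrightarrow> M > 1 \<and> \<epsilon> > 0 \<and>
      1 \<le> ln (M\<^sup>2 * ln M) + ln (1 / \<epsilon>) \<and> ln \<epsilon> \<le> ln (M\<^sup>2 * ln M) + ln (1 / \<epsilon>)"
    proof (intro exI[of _ "min 1 (c / exp 1)"] conjI allI impI; (elim conjE)?)
      show "0 < min 1 (c / exp 1)" using c by simp
    next
      fix M \<epsilon> assume a: "M \<ge> M0" "0 < \<epsilon>" "\<epsilon> < min 1 (c / exp 1)"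
      have "c \<le> M\<^sup>2 * ln M"
        unfolding c_def using a M0 by (intro mult_mono power_mono) auto
      moreover have "exp 1 * \<epsilon> \<le> c"
        using a by (simp add: field_simps)
      ultimately have ge1: "1 \<le> ln (M\<^sup>2 * ln M) + ln (1 / \<epsilon>)"
        using ln_ge[of M \<epsilon> "exp 1"] a M0 by simp
      then show "1 \<le> ln (M\<^sup>2 * ln M) + ln (1 / \<epsilon>)" .
      have "ln \<epsilon> \<le> 0" using a by simp
      then show "ln \<epsilon> \<le> ln (M\<^sup>2 * ln M) + ln (1 / \<epsilon>)" using ge1 by linarith
    qed (use M0 in auto)
  next
    fix e0 :: real assume e0: "e0 > 0"
    \<comment> \<open>The threshold combines three demands: \<open>exp 1\<close> makes
      \<open>ln M \<ge> 1\<close>, hence \<open>M \<le> M\<^sup>2 * ln M\<close>; the other two put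
      \<open>exp 1 * \<epsilon>\<close> and \<open>\<epsilon> * \<epsilon>\<close> below
      \<open>M\<close>.\<close>
    show "\<exists>M1. \<forall>M\<ge>M1. \<forall>\<epsilon>. 0 < \<epsilon> \<and> \<epsilon> \<le> e0 \<longrightarrow> M > 1 \<and> \<epsilon> > 0 \<and>
      1 \<le> ln (M\<^sup>2 * ln M) + ln (1 / \<epsilon>) \<and> ln \<epsilon> \<le> ln (M\<^sup>2 * ln M) + ln (1 / \<epsilon>)"
    proof (intro exI[of _ "max (exp 1) (max (exp 1 * e0) (e0 * e0))"] allI impI; elim conjE)
      fix M \<epsilon> assume a: "M \<ge> max (exp 1) (max (exp 1 * e0) (e0 * e0))" "0 < \<epsilon>" "\<epsilon> \<le> e0"
      have aM: "exp 1 * e0 \<le> M" "e0 * e0 \<le> M"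
        using a by simp_all
      have M: "M > 1"
        using a by (intro less_le_trans[of 1 "exp 1" M]) auto
      have "ln M \<ge> 1"
        using a M by (simp add: ln_ge_iff)
      then have "M * 1 \<le> M\<^sup>2 * ln M"
        using M by (intro mult_mono) (auto simp: power2_eq_square)
      moreover have "exp 1 * \<epsilon> \<le> M"
        using a mult_left_mono[of \<epsilon> e0 "exp 1"] by (intro order_trans[OF _ aM(1)]) simp
      moreover have "\<epsilon> * \<epsilon> \<le> M"
        using a by (intro order_trans[OF _ aM(2)] mult_mono) simp_all
      ultimately show "M > 1 \<and> \<epsilon> > 0 \<and>
          1 \<le> ln (M\<^sup>2 * ln M) + ln (1 / \<epsilon>) \<and> ln \<epsilon> \<le> ln (M\<^sup>2 * ln M) + ln (1 / \<epsilon>)"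
        using ln_ge[of M \<epsilon> "exp 1"] ln_ge[of M \<epsilon> \<epsilon>] M a by simp
    qed
  qed
qed

lemma num_squarings_bigo:
  "(\<lambda>(M, \<epsilon>). real (num_squarings M \<epsilon>))
     \<in> O[growth_filter](\<lambda>(M, \<epsilon>). ln (M\<^sup>2 * ln M) + ln (1 / \<epsilon>))"
proof (rule bigoI[of _ 11])
  show "\<forall>\<^sub>F p in growth_filter. norm (case p of (M, \<epsilon>) \<Rightarrow> real (num_squarings M \<epsilon>))
      \<le> 11 * norm (case p of (M, \<epsilon>) \<Rightarrow> ln (M\<^sup>2 * ln M) + ln (1 / \<epsilon>))"
    using eventually_growth_filter_ln
  proof eventually_elim
    case (elim p)
    obtain M \<epsilon> where [simp]: "p = (M, \<epsilon>)" by (cases p)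
    show ?case
      using elim num_squarings_le[of M \<epsilon>, OF _ _ refl] by simp
  qed
qed

section \<open>Representation by repeated squaring\<close>

lemma psi_le_ratio_iff_tower:
  fixes a b c :: real
  assumes "a > 0" "b > 0" "N \<ge> 1"
  shows "psi N (c / b) \<le> a / b \<longleftrightarrow>
    (\<exists>r :: nat \<Rightarrow> real. (\<forall>k\<in>{1..N - 1}. r k \<ge> 0) \<and> (r 1)\<^sup>2 \<le> a * b \<and>
       (\<forall>k\<in>{1..N - 1}. (r (k + 1))\<^sup>2 \<le> r k * b) \<and> r N = b + c / 2 ^ N)"
    (is "_ \<longleftrightarrow> (\<exists>r. ?T r)")
proof -
  define u where "u = 1 + c / b / 2 ^ N"
  have bu: "b * u = b + c / 2 ^ N"
    using assms by (simp add: u_def field_simps)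
  have psi: "psi N (c / b) = u ^ 2 ^ N"
    by (simp add: psi_def u_def)
  show ?thesis
  proof
    assume le: "psi N (c / b) \<le> a / b"
    \<comment> \<open>This choice starts from \<open>r N = b * u\<close> and makes every constraint
      after the first an equality; the first one becomes the assumed inequality.\<close>
    define r where "r k = b * u ^ 2 ^ (N - k)" for k
    have sq: "(r (Suc k))\<^sup>2 = b\<^sup>2 * u ^ 2 ^ (N - k)" if "k < N" for k
    proof -
      have "N - k = Suc (N - Suc k)" using that by simp
      then show ?thesis
        by (simp add: r_def power_mult_distrib mult.commute flip: power_mult)
    qed
    \<comment> \<open>For \<open>k < N\<close> the exponent is even, so the power is nonnegative
      whatever the sign of \<open>u\<close>.\<close>
    have "r k \<ge> 0" if "k \<in> {1..N - 1}" for k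
      using that assms by (auto simp: r_def intro!: mult_nonneg_nonneg zero_le_even_power)
    moreover have "(r 1)\<^sup>2 \<le> a * b"
      using sq[of 0] le assms by (simp add: psi power2_eq_square field_simps)
    moreover have "(r (k + 1))\<^sup>2 \<le> r k * b" if "k \<in> {1..N - 1}" for k
    proof -
      have "k < N" using that by auto
      then have "(r (k + 1))\<^sup>2 = r k * b"
        using sq[of k] unfolding Suc_eq_plus1 by (simp add: r_def[of k] power2_eq_square)
      then show ?thesis by simp
    qed
    moreover have "r N = b + c / 2 ^ N"
      by (simp add: r_def bu)
    ultimately show "\<exists>r. ?T r" by blast
  next
    assume "\<exists>r. ?T r"
    then obtain r where r1: "(r 1)\<^sup>2 \<le> a * b" and rN: "r N = b + c / 2 ^ N"
      and sq_step: "\<And>k. k \<in> {1..N - 1} \<Longrightarrow> (r (k + 1))\<^sup>2 \<le> r k * b"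
      by blast
    \<comment> \<open>Divided by \<open>b\<^sup>2\<close>, each constraint bounds the square of one
      ratio \<open>r (k + 1) / b\<close> by the previous ratio, so the bounds telescope. Taking
      powers is monotone because the smaller side is a square.\<close>
    have "k \<le> N \<longrightarrow> (r k / b) ^ 2 ^ k \<le> a / b" if "k \<ge> 1" for k
      using that
    proof (induction k rule: dec_induct)
      case base
      show ?case using r1 assms by (simp add: power2_eq_square field_simps)
    next
      case (step k)
      show ?case
      proof
        assume k: "Suc k \<le> N"
        have "(r (Suc k) / b)\<^sup>2 \<le> r k / b"
          using \<open>1 \<le> k\<close> k assms sq_step[of k]
          by (simp add: power2_eq_square field_simps)
        then have "((r (Suc k) / b)\<^sup>2) ^ 2 ^ k \<le> (r k / b) ^ 2 ^ k"
          by (intro power_mono) auto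
        also have "\<dots> \<le> a / b"
          using step.IH k by simp
        finally show "(r (Suc k) / b) ^ 2 ^ Suc k \<le> a / b"
          by (simp flip: power_mult)
      qed
    qed
    moreover have "r N / b = u"
      using assms by (simp add: rN flip: bu)
    ultimately show "psi N (c / b) \<le> a / b"
      using assms(3) by (metis order_refl psi)
  qed
qed

text \<open>The sign condition \<open>b + c \<ge> 0\<close> of the cone criterion is automatic here:
  points of the box have positive coordinates, and \<open>r k \<ge> 0\<close> is part of the system.
  The quadratic inequalities that remain are those of \<open>psi_le_ratio_iff_tower\<close>.\<close>

lemma K_psi_eq_lorentz3:
  assumes "M > 1" and "N \<ge> 1"
  shows "K_psi M N =
    {x. x $ 1 \<in> box_R M \<and> x $ 2 \<in> box_R M \<and>
        (\<exists>r :: nat \<Rightarrow> real.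
           (\<forall>k\<in>{1..N - 1}. r k \<ge> 0) \<and>
           vector [2 * r 1, x $ 1 - x $ 2, x $ 1 + x $ 2] \<in> lorentz3 \<and>
           (\<forall>k\<in>{1..N - 1}.
              vector [2 * r (k + 1), r k - x $ 2, r k + x $ 2] \<in> lorentz3) \<and>
           r N = x $ 2 + x $ 3 / 2 ^ N)}"
proof -
  have pos: "y > 0" if "y \<in> box_R M" for y
    using that assms by (auto simp: box_R_def intro: less_le_trans[of 0 "1 / M"])
  show ?thesis
    unfolding K_psi_def vector_in_lorentz3_iff
  proof (intro Collect_cong conj_cong refl)
    fix x :: "real ^ 3"
    assume "x $ 1 \<in> box_R M" "x $ 2 \<in> box_R M"
    then have p: "x $ 1 > 0" "x $ 2 > 0" using pos by auto
    show "psi N (x $ 3 / x $ 2) \<le> x $ 1 / x $ 2 \<longleftrightarrow> (\<exists>r :: nat \<Rightarrow> real.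
       (\<forall>k\<in>{1..N - 1}. r k \<ge> 0) \<and>
       (0 \<le> x $ 1 + x $ 2 \<and> (r 1)\<^sup>2 \<le> x $ 1 * x $ 2) \<and>
       (\<forall>k\<in>{1..N - 1}. 0 \<le> r k + x $ 2 \<and> (r (k + 1))\<^sup>2 \<le> r k * x $ 2) \<and>
       r N = x $ 2 + x $ 3 / 2 ^ N)"
      unfolding psi_le_ratio_iff_tower[OF p assms(2)]
      using p by (intro ex_cong1 conj_cong ball_cong refl) (auto intro: add_nonneg_nonneg)
  qed
qed

theorem theorem3:
  shows "(\<exists>N :: real \<Rightarrow> real \<Rightarrow> nat.
            (\<forall>M>1. \<forall>\<epsilon>\<in>{0 <..< 2 * M\<^sup>2 * ln M}.
               N M \<epsilon> \<ge> 1 \<and>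
               K_exp M 0 \<inter> slab M \<subseteq> K_psi M (N M \<epsilon>) \<inter> slab M \<and>
               K_psi M (N M \<epsilon>) \<inter> slab M \<subseteq> K_exp M \<epsilon> \<inter> slab M) \<and>
            (\<lambda>(M, \<epsilon>). real (N M \<epsilon>))
              \<in> O[growth_filter](\<lambda>(M, \<epsilon>). ln (M\<^sup>2 * ln M) + ln (1 / \<epsilon>))) \<and>
         (\<forall>M>1. \<forall>N::nat. N \<ge> 1 \<longrightarrow>
            K_psi M N =
              {x. x $ 1 \<in> box_R M \<and> x $ 2 \<in> box_R M \<and>
                  (\<exists>r :: nat \<Rightarrow> real.
                     (\<forall>k\<in>{1..N - 1}. r k \<ge> 0) \<and>
                     vector [2 * r 1, x $ 1 - x $ 2, x $ 1 + x $ 2] \<in> lorentz3 \<and>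
                     (\<forall>k\<in>{1..N - 1}.
                        vector [2 * r (k + 1), r k - x $ 2, r k + x $ 2] \<in> lorentz3) \<and>
                     r N = x $ 2 + x $ 3 / 2 ^ N)})"
proof (intro conjI exI[of _ num_squarings] allI impI ballI num_squarings_bigo)
  fix M \<epsilon> :: real
  assume M: "M > 1" and \<epsilon>: "\<epsilon> \<in> {0<..<2 * M\<^sup>2 * ln M}"
  show "num_squarings M \<epsilon> \<ge> 1"
    by (simp add: num_squarings_def)
  have sq: "2 * (2 * M\<^sup>2 * ln M)\<^sup>2 / \<epsilon> \<le> 2 ^ num_squarings M \<epsilon>"
    using two_power_num_squarings M \<epsilon> by simp
  show "K_exp M 0 \<inter> slab M \<subseteq> K_psi M (num_squarings M \<epsilon>) \<inter> slab M"
    using \<epsilon> by (intro K_psi_between_K_exp(1)[OF M _ _ refl sq]) simp_all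
  show "K_psi M (num_squarings M \<epsilon>) \<inter> slab M \<subseteq> K_exp M \<epsilon> \<inter> slab M"
    using \<epsilon> by (intro K_psi_between_K_exp(2)[OF M _ _ refl sq]) simp_all
qed (rule K_psi_eq_lorentz3)

end
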